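(* Let $r>0$ and let the improvement set be the closed $\ell_\infty$ ball of radius $r$, $\Delta(x)=\{x':\|x-x'\|_\infty\le r\}$. Let $R^*\in\mathcal{H}_{\mathrm{rec}}$ be the target rectangle and let $R^c_S$ be the rectangle returned by the closure algorithm given a sample $S$ of $m$ i.i.d. examples from $\mathcal{D}$ labeled by $R^*$. There is a universal constant $C$ such that, for any distribution $\mathcal{D}$ and any $\epsilon,\delta\in(0,1/2)$, if $m\ge\frac{C}{\epsilon}\left(d+\log\frac1\delta\right)$ (i.e. with sample complexity $M=O(\frac1\epsilon(d+\log\frac1\delta))$), then with probability at least $1-\delta$, $$\mathrm{Loss}_{\mathcal{D}}(R^c_S,R^* )\le\Bigl(\epsilon-\mathbb{P}_{x\sim\mathcal{D}}\bigl[x\in\mathrm{IR}(R^c_S;R^*,\Delta)\bigr]\Bigr)_+ .$$ Moreover, when $d=2$ and $\mathcal{D}$ is the uniform distribution on $[0,1]^2$, denoting by $l_1$ and $l_2$ the width and height of the rectangle $R^c_S$, $$\mathbb{P}_{x\sim\mathcal{D}}\bigl[x\in\mathrm{IR}(R^c_S;R^*,\Delta)\bigr]=2r(l_1+l_2)+4r^2 .$$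
   Context: $(a)_+=\max\{a,0\}$. Classifiers are identified with the sets of points they label $1$. For $a,b\in[0,1]^d$ with $a_i\le b_i$ for all $i$, the axis-aligned hyperrectangle $R_{(a,b)}=\prod_{i=1}^d[a_i,b_i]$ classifies $x$ as $R_{(a,b)}(x)=\mathbb{I}\{x_i\in[a_i,b_i]\ \forall i\}$; $\mathcal{H}_{\mathrm{rec}}=\{R_{(a,b)}:a,b\in[0,1]^d\}$, on the instance space $[0,1]^d$. Closure algorithm: for a class $\mathcal{H}$ on $\mathcal{X}$ and $A\subseteq\mathcal{X}$, $\mathrm{CLOS}_{\mathcal{H}}(A)=\bigcap_{h\in\mathcal{H},A\subseteq h}h$ (equal to $\mathcal{X}$ if no $h\in\mathcal{H}$ contains $A$). Given a labeled sample $S$, the closure algorithm returns the classifier that labels $1$ exactly the points of $\mathrm{CLOS}_{\mathcal{H}}(\{x_i\in S:y_i=1\})$; here $\mathcal{H}=\mathcal{H}_{\mathrm{rec}}$ and the output is denoted $R^c_S$. For a classifier $h$ the reaction set of $x$ is: $\Delta_h(x)=\{x\}$ if $h(x)=1$; $\Delta_h(x)=\{x\}$ if $\{x'\in\Delta(x): h(x')=1\}=\emptyset$; and $\Delta_h(x)=\{x'\in\Delta(x):h(x')=1\}$ otherwise. For a target $f^*$, $\mathrm{Loss}(x;h,f^* )=\max_{x'\in\Delta_h(x)}\mathbb{I}[h(x')\neq f^*(x')]$ and $\mathrm{Loss}_{\mathcal{D}}(h,f^* )=\mathbb{P}_{x\sim\mathcal{D}}[\mathrm{Loss}(x;h,f^*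 )=1]$. Improvement region: for $h\subseteq f^*$, $\mathrm{IR}(h;f^*,\Delta)=\{x:h(x)=0,\ \exists x'\in\Delta(x): h(x')=f^*(x')=1\}$.
   Formalization: As stated both parts can fail: the loss bound is proved with the improvement region intersected with R* (points outside R* do not reduce the loss), and the area formula assumes R^c_S is nonempty and at distance at least r from the boundary of the unit square. *)

theory Defs
  imports "HOL-Probability.Probability"
begin

text \<open>
  The constant in the sample bound has to be independent of the dimension, so points of
  \<open>[0,1]\<close>-to-the-\<open>d\<close> are extensional functions on \<open>{..<d}\<close> rather than vectors of a type-indexed
  dimension.  A classifier is the set of points that it labels 1.
\<close>

type_synonym point = "nat \<Rightarrow> real"

definition cube :: "nat \<Rightarrow> point set" where
  "cube d = {..<d} \<rightarrow>\<^sub>E {0..1}"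

definition cube_borel :: "nat \<Rightarrow> point measure" where
  "cube_borel d = Pi\<^sub>M {..<d} (\<lambda>_. restrict_space borel {0..1})"

definition uniform_cube :: "nat \<Rightarrow> point measure" where
  "uniform_cube d = Pi\<^sub>M {..<d} (\<lambda>_. restrict_space lborel {0..1})"

definition rect :: "nat \<Rightarrow> point \<Rightarrow> point \<Rightarrow> point set" where
  "rect d a b = {x \<in> cube d. \<forall>i<d. a i \<le> x i \<and> x i \<le> b i}"

definition H_rec :: "nat \<Rightarrow> point set set" where
  "H_rec d = {rect d a b | a b. a \<in> cube d \<and> b \<in> cube d \<and> (\<forall>i<d. a i \<le> b i)}"

definition CLOS :: "'a set \<Rightarrow> 'a set set \<Rightarrow> 'a set \<Rightarrow> 'a set" where
  "CLOS X H A = X \<inter> \<Inter>{h \<in> H. A \<subseteq> h}"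

text \<open>A labeled sample of size \<open>m\<close> is a function on \<open>{..<m}\<close>; other values are ignored.\<close>

definition labeled :: "'a set \<Rightarrow> (nat \<Rightarrow> 'a) \<Rightarrow> nat \<Rightarrow> 'a \<times> bool" where
  "labeled f xs = (\<lambda>i. (xs i, xs i \<in> f))"

definition closure_alg :: "nat \<Rightarrow> nat \<Rightarrow> (nat \<Rightarrow> point \<times> bool) \<Rightarrow> point set" where
  "closure_alg d m S = CLOS (cube d) (H_rec d) {fst (S i) | i. i < m \<and> snd (S i)}"

text \<open>The maximum below is meaningful only for \<open>d \<ge> 1\<close>.\<close>

definition linf_dist :: "nat \<Rightarrow> point \<Rightarrow> point \<Rightarrow> real" where
  "linf_dist d x y = (MAX i\<in>{..<d}. \<bar>x i - y i\<bar>)"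

definition linf_ball :: "nat \<Rightarrow> real \<Rightarrow> point \<Rightarrow> point set" where
  "linf_ball d r x = {x' \<in> cube d. linf_dist d x x' \<le> r}"

definition reaction_set :: "('a \<Rightarrow> 'a set) \<Rightarrow> 'a set \<Rightarrow> 'a \<Rightarrow> 'a set" where
  "reaction_set \<Delta> h x =
     (if x \<in> h then {x}
      else if {x' \<in> \<Delta> x. x' \<in> h} = {} then {x}
      else {x' \<in> \<Delta> x. x' \<in> h})"

text \<open>The reaction set may be infinite, but only the values 0 and 1 are maximised over.\<close>

definition loss :: "('a \<Rightarrow> 'a set) \<Rightarrow> 'a set \<Rightarrow> 'a set \<Rightarrow> 'a \<Rightarrow> nat" where
  "loss \<Delta> h f x = (MAX x'\<in>reaction_set \<Delta> h x. of_bool ((x' \<in> h) \<noteq> (x' \<in> f)))"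

definition pop_loss :: "'a measure \<Rightarrow> ('a \<Rightarrow> 'a set) \<Rightarrow> 'a set \<Rightarrow> 'a set \<Rightarrow> real" where
  "pop_loss D \<Delta> h f = \<P>(x in D. loss \<Delta> h f x = 1)"

text \<open>
  Points outside \<open>f\<close> belong to the improvement region as soon as they can reach \<open>h\<close>.  Such points
  never account for any part of the error region \<open>f - h\<close>, so a bound on the loss can only be
  credited with the part of \<open>IR X \<Delta> h f\<close> lying inside \<open>f\<close>.
\<close>

definition IR :: "'a set \<Rightarrow> ('a \<Rightarrow> 'a set) \<Rightarrow> 'a set \<Rightarrow> 'a set \<Rightarrow> 'a set" where
  "IR X \<Delta> h f = {x \<in> X. x \<notin> h \<and> (\<exists>x'\<in>\<Delta> x. x' \<in> h \<and> x' \<in> f)}"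

text \<open>Side length of a (nonempty) rectangle in coordinate direction \<open>i\<close>.\<close>

definition side_length :: "nat \<Rightarrow> point set \<Rightarrow> real" where
  "side_length i R = (SUP x\<in>R. x i) - (INF x\<in>R. x i)"

end

theory Submission
  imports Defs
begin

text \<open>
  The closure of the positive examples is the smallest box around them, and it lies inside the
  target.  A point outside the box errs after reacting only if it is in the target and cannot reach
  the box, so the loss is the mass of the target missed by the box minus the mass of the improvement
  region inside the target.  It therefore suffices that the missed mass exceeds \<open>\<epsilon>\<close> with probability
  at most \<open>\<delta>\<close>.

  To avoid a factor \<open>ln d\<close>, split the sample indices into \<open>4 * d\<close> residue classes.  The box is
  determined by at most \<open>2 * d\<close> points, hence by the points in some collection of at most \<open>2 * d\<close>
  classes.  For a fixed collection the points in the remaining classes, roughly \<open>m / 2\<close> of them, are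
  independent of that box and must all avoid the region it misses; if this region has mass above \<open>\<epsilon>\<close>,
  that happens with probability at most about \<open>(1 - \<epsilon>)\<close> to the power \<open>m / 2\<close>.  A union bound over the at most \<open>2 ^ (4 * d)\<close> collections concludes.
\<close>

section \<open>Bounding boxes, closures, reachability and loss\<close>

text \<open>For finite nonempty \<open>A\<close> and \<open>t \<ge> 0\<close> this is the bounding
  box of \<open>A\<close> widened by \<open>t\<close> on every side and cut off at the cube; for
  empty \<open>A\<close> it is empty once \<open>d \<ge> 1\<close>. The existential form avoids
  extrema of an empty set and reduces measurability to finite quantifiers.\<close>

definition box_nbhd :: "nat \<Rightarrow> real \<Rightarrow> point set \<Rightarrow> point set" where
  "box_nbhd d t A =
     {x \<in> cube d. \<forall>j<d. (\<exists>y\<in>A. y j - t \<le> x j) \<and> (\<exists>y\<in>A. x j \<le> y j + t)}"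

lemma coordinate_extremes:
  fixes A :: "point set"
  assumes "finite A" "A \<noteq> {}"
  obtains l h where "\<And>j. l j \<in> A" "\<And>j. h j \<in> A" "\<And>j y. y \<in> A \<Longrightarrow> l j j \<le> y j \<and> y j \<le> h j j"
proof -
  have "\<exists>y\<in>A. \<forall>z\<in>A. y j \<le> z j" for j
    using ex_is_arg_min_if_finite[OF assms, of "\<lambda>x. x j"] by (force simp: is_arg_min_linorder)
  moreover have "\<exists>y\<in>A. \<forall>z\<in>A. z j \<le> y j" for j
    using ex_is_arg_min_if_finite[OF assms, of "\<lambda>x. - x j"] by (force simp: is_arg_min_linorder)
  ultimately show thesis using that by metis
qed

text \<open>Only the extreme points matter: any subset of a sample that still contains them has the
  same box. The compression argument rests on this.\<close>

lemma box_nbhd_eq: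
  assumes "\<And>j. j < d \<Longrightarrow> l j \<in> A" "\<And>j. j < d \<Longrightarrow> h j \<in> A"
    and "\<And>j y. j < d \<Longrightarrow> y \<in> A \<Longrightarrow> l j j \<le> y j \<and> y j \<le> h j j"
  shows "box_nbhd d t A = {x \<in> cube d. \<forall>j<d. l j j - t \<le> x j \<and> x j \<le> h j j + t}"
proof -
  have "(\<exists>y\<in>A. y j - t \<le> x j) \<longleftrightarrow> l j j - t \<le> x j" "(\<exists>y\<in>A. x j \<le> y j + t) \<longleftrightarrow> x j \<le> h j j + t"
    if j: "j < d" for x j
  proof -
    have "l j j - t \<le> x j" if "y \<in> A" "y j - t \<le> x j" for y using assms(3)[OF j that(1)] that by linarith
    then show "(\<exists>y\<in>A. y j - t \<le> x j) \<longleftrightarrow> l j j - t \<le> x j" using assms(1)[OF j] by blast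
    have "x j \<le> h j j + t" if "y \<in> A" "x j \<le> y j + t" for y using assms(3)[OF j that(1)] that by linarith
    then show "(\<exists>y\<in>A. x j \<le> y j + t) \<longleftrightarrow> x j \<le> h j j + t" using assms(2)[OF j] by blast
  qed
  then show ?thesis unfolding box_nbhd_def by simp
qed

text \<open>Every rectangle containing \<open>A\<close> contains its bounding box, and for nonempty
  \<open>A\<close> the bounding box is itself a rectangle of the class.\<close>

lemma CLOS_rec_eq:
  assumes "d \<ge> 1" "finite A" "A \<subseteq> cube d"
  shows "CLOS (cube d) (H_rec d) A = box_nbhd d 0 A"
proof
  show "box_nbhd d 0 A \<subseteq> CLOS (cube d) (H_rec d) A"
  proof
    fix x assume x: "x \<in> box_nbhd d 0 A"
    have "x \<in> rect d a b" if "A \<subseteq> rect d a b" for a b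
    proof -
      have "a j \<le> x j \<and> x j \<le> b j" if j: "j < d" for j
      proof -
        obtain y z where "y \<in> A" "y j \<le> x j" "z \<in> A" "x j \<le> z j"
          using x j unfolding box_nbhd_def by auto
        moreover from this have "a j \<le> y j" "z j \<le> b j"
          using \<open>A \<subseteq> rect d a b\<close> j by (auto simp: rect_def)
        ultimately show ?thesis by linarith
      qed
      then show ?thesis using x unfolding rect_def box_nbhd_def by auto
    qed
    then show "x \<in> CLOS (cube d) (H_rec d) A"
      using x unfolding CLOS_def H_rec_def box_nbhd_def by auto
  qed
  show "CLOS (cube d) (H_rec d) A \<subseteq> box_nbhd d 0 A"
  proof (cases "A = {}")
    case True
    \<comment> \<open>The class has no empty member, so the empty closure comes from two disjoint
      one-point rectangles, at the all-zeros and the all-ones corner.\<close>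
    define c :: "real \<Rightarrow> point" where "c t = (\<lambda>j\<in>{..<d}. t)" for t
    have "c t \<in> cube d" if "t \<in> {0..1}" for t
      using that unfolding c_def cube_def by auto
    then have "c t \<in> cube d \<and> c t \<in> cube d \<and> (\<forall>i<d. c t i \<le> c t i)" if "t \<in> {0..1}" for t
      using that by blast
    then have "rect d (c t) (c t) \<in> H_rec d" if "t \<in> {0..1}" for t
      using that unfolding H_rec_def by blast
    then have "rect d (c 0) (c 0) \<in> H_rec d" "rect d (c 1) (c 1) \<in> H_rec d"
      by simp_all
    moreover have "rect d (c 0) (c 0) \<inter> rect d (c 1) (c 1) = {}"
      using \<open>d \<ge> 1\<close> unfolding rect_def c_def by force
    ultimately show ?thesis unfolding CLOS_def True by blast
  next
    case False
    obtain l h where lh: "\<And>j. l j \<in> A" "\<And>j. h j \<in> A" "\<And>j y. y \<in> A \<Longrightarrow> l j j \<le> y j \<and> y j \<le> h j j"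
      using coordinate_extremes[OF \<open>finite A\<close> False] by metis
    have box: "box_nbhd d 0 A = {x \<in> cube d. \<forall>j<d. l j j - 0 \<le> x j \<and> x j \<le> h j j + 0}"
      using lh by (intro box_nbhd_eq[of d l _ h]) auto
    let ?l = "\<lambda>j\<in>{..<d}. l j j" and ?h = "\<lambda>j\<in>{..<d}. h j j"
    let ?R = "rect d ?l ?h"
    have R: "?R = box_nbhd d 0 A"
      unfolding box rect_def by auto
    have c: "l j j \<in> {0..1}" "h j j \<in> {0..1}" if "j < d" for j
      using assms(3) lh(1)[of j] lh(2)[of j] that unfolding cube_def by (auto simp: PiE_iff subset_iff)
    have "?l \<in> cube d" "?h \<in> cube d" "\<forall>j<d. ?l j \<le> ?h j"
      using c lh by (auto simp: cube_def)
    then have "?R \<in> H_rec d" unfolding H_rec_def by blast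
    moreover have "A \<subseteq> ?R" unfolding R box using assms(3) lh(3) by auto
    ultimately show ?thesis unfolding CLOS_def R by blast
  qed
qed

lemma linf_dist_le_iff: "d \<ge> 1 \<Longrightarrow> linf_dist d x y \<le> r \<longleftrightarrow> (\<forall>j<d. \<bar>x j - y j\<bar> \<le> r)"
  unfolding linf_dist_def by (subst Max_le_iff) (auto simp: lessThan_empty_iff)

text \<open>Distance in the maximum norm is controlled coordinate by coordinate, so each coordinate
  can be moved into the box independently of the others.\<close>

lemma reach_box_nbhd:
  assumes "d \<ge> 1" "A \<subseteq> cube d" "r \<ge> 0" "x \<in> cube d"
  shows "(\<exists>x'\<in>linf_ball d r x. x' \<in> box_nbhd d 0 A) \<longleftrightarrow> x \<in> box_nbhd d r A"
proof
  assume "\<exists>x'\<in>linf_ball d r x. x' \<in> box_nbhd d 0 A"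
  then obtain x' where x': "x' \<in> box_nbhd d 0 A" "\<And>j. j < d \<Longrightarrow> \<bar>x j - x' j\<bar> \<le> r"
    using assms(1) by (auto simp: linf_ball_def linf_dist_le_iff)
  show "x \<in> box_nbhd d r A"
    unfolding box_nbhd_def mem_Collect_eq
  proof (intro conjI allI impI assms(4))
    fix j assume j: "j < d"
    obtain y z where "y \<in> A" "y j \<le> x' j" "z \<in> A" "x' j \<le> z j"
      using x'(1) j unfolding box_nbhd_def by auto
    with x'(2)[OF j] show "\<exists>y\<in>A. y j - r \<le> x j" "\<exists>y\<in>A. x j \<le> y j + r"
      by (auto intro: bexI[of _ y] bexI[of _ z])
  qed
next
  assume x: "x \<in> box_nbhd d r A"
  \<comment> \<open>The witness is \<open>x j\<close> itself if it already lies between coordinates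
    of points of \<open>A\<close>, and otherwise \<open>y j\<close> or \<open>z j\<close>, depending
    on the side.\<close>
  have "\<exists>v. (\<exists>y\<in>A. y j \<le> v) \<and> (\<exists>y\<in>A. v \<le> y j) \<and> \<bar>x j - v\<bar> \<le> r" if j: "j < d" for j
  proof -
    obtain y z where yz: "y \<in> A" "y j - r \<le> x j" "z \<in> A" "x j \<le> z j + r"
      using x j unfolding box_nbhd_def by auto
    show ?thesis
    proof (cases "y j > x j \<or> z j < x j")
      case True
      then have "y j > x j \<or> y j \<le> x j \<and> z j < x j" by auto
      then show ?thesis
      proof
        assume "y j > x j"
        then show ?thesis using yz by (intro exI[of _ "y j"]) auto
      next
        assume "y j \<le> x j \<and> z j < x j"
        then show ?thesis using yz by (intro exI[of _ "z j"]) auto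
      qed
    next
      case False
      with yz have "\<exists>y\<in>A. y j \<le> x j" "\<exists>y\<in>A. x j \<le> y j"
        by (meson not_less)+
      then show ?thesis using assms(3) by (intro exI[of _ "x j"]) auto
    qed
  qed
  then obtain v where v: "\<And>j. j < d \<Longrightarrow> (\<exists>y\<in>A. y j \<le> v j) \<and> (\<exists>y\<in>A. v j \<le> y j) \<and> \<bar>x j - v j\<bar> \<le> r"
    by metis
  \<comment> \<open>Moving into the box does not leave the cube, since \<open>v j\<close> lies
    between coordinates of points of \<open>A\<close>.\<close>
  have "v j \<in> {0..1}" if j: "j < d" for j
  proof -
    obtain y z where "y \<in> A" "y j \<le> v j" "z \<in> A" "v j \<le> z j"
      using v[OF j] by auto
    moreover from this have "y j \<in> {0..1}" "z j \<in> {0..1}"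
      using assms(2) j by (auto simp: cube_def PiE_iff subset_iff)
    ultimately show ?thesis by auto
  qed
  then have "restrict v {..<d} \<in> cube d" by (auto simp: cube_def)
  then show "\<exists>x'\<in>linf_ball d r x. x' \<in> box_nbhd d 0 A"
    using v assms(1) by (intro bexI[of _ "restrict v {..<d}"])
      (auto simp: linf_ball_def linf_dist_le_iff box_nbhd_def)
qed

text \<open>A point that moves into \<open>h\<close> lands in \<open>f\<close> as well and causes no
  error; a point that stays put errs exactly on \<open>f - h\<close>.\<close>

lemma loss_eq_1_iff:
  assumes "h \<subseteq> f"
  shows "loss \<Delta> h f x = 1 \<longleftrightarrow> x \<in> f \<and> x \<notin> h \<and> \<not> (\<exists>x'\<in>\<Delta> x. x' \<in> h)"
proof (cases "x \<notin> h \<and> (\<exists>x'\<in>\<Delta> x. x' \<in> h)")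
  case True
  then have "reaction_set \<Delta> h x = {x' \<in> \<Delta> x. x' \<in> h}" and ne: "{x' \<in> \<Delta> x. x' \<in> h} \<noteq> {}"
    unfolding reaction_set_def by auto
  then have "loss \<Delta> h f x = (MAX x'\<in>{x' \<in> \<Delta> x. x' \<in> h}. 0)"
    unfolding loss_def using assms by (intro arg_cong[of _ _ Max] image_cong) auto
  also have "\<dots> = 0" using ne by (simp only: image_constant_conv) simp
  finally show ?thesis using True by auto
next
  case False
  then have "reaction_set \<Delta> h x = {x}"
    unfolding reaction_set_def by auto
  then show ?thesis using False assms unfolding loss_def by auto
qed

section \<open>Avoidance probabilities and the sample size\<close>

text \<open>By Fubini, integrate over the coordinates in \<open>J\<close> first: with those in
  \<open>K\<close> fixed, \<open>B\<close> is a fixed set, and each of the independent points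
  indexed by \<open>J\<close> avoids it with probability below \<open>1 - e\<close> whenever its
  mass exceeds \<open>e\<close>.\<close>

lemma (in prob_space) emeasure_PiM_avoid_le:
  assumes "finite K" "finite J" "K \<inter> J = {}"
    and cong: "\<And>xs ys. (\<And>i. i \<in> K \<Longrightarrow> xs i = ys i) \<Longrightarrow> B xs = B ys"
    and B: "\<And>xs. xs \<in> space (Pi\<^sub>M K (\<lambda>_. M)) \<Longrightarrow> B xs \<in> sets M"
    and E: "{xs \<in> space (Pi\<^sub>M (K \<union> J) (\<lambda>_. M)). prob (B xs) > e \<and> (\<forall>i\<in>J. xs i \<notin> B xs)}
              \<in> sets (Pi\<^sub>M (K \<union> J) (\<lambda>_. M))" (is "?E \<in> _")
    and e: "e \<le> 1"
  shows "emeasure (Pi\<^sub>M (K \<union> J) (\<lambda>_. M)) ?E \<le> ennreal ((1 - e) ^ card J)"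
proof -
  interpret product_sigma_finite "\<lambda>_. M" ..
  interpret PK: prob_space "Pi\<^sub>M K (\<lambda>_. M)" by (intro prob_space_PiM prob_space_axioms)
  have inner: "(\<integral>\<^sup>+ y. indicator ?E (merge K J (x, y)) \<partial>Pi\<^sub>M J (\<lambda>_. M)) \<le> ennreal ((1 - e) ^ card J)"
    if x: "x \<in> space (Pi\<^sub>M K (\<lambda>_. M))" for x
  proof -
    \<comment> \<open>\<open>B\<close> reads only the coordinates in \<open>K\<close>, so it does
      not change with \<open>y\<close>.\<close>
    have Bm: "B (merge K J (x, y)) = B x" for y
      by (rule cong) (simp add: merge_def)
    have mE: "merge K J (x, y) \<in> ?E \<longleftrightarrow> prob (B x) > e \<and> y \<in> Pi\<^sub>E J (\<lambda>_. space M - B x)"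
      if y: "y \<in> space (Pi\<^sub>M J (\<lambda>_. M))" for y
    proof -
      have "merge K J (x, y) \<in> space (Pi\<^sub>M (K \<union> J) (\<lambda>_. M))"
        using x y by (auto simp: space_PiM merge_def PiE_iff extensional_def)
      moreover have "merge K J (x, y) i = y i" if "i \<in> J" for i
        using that assms(3) by (auto simp: merge_def)
      ultimately show ?thesis
        using y unfolding mem_Collect_eq Bm by (auto simp: space_PiM PiE_iff)
    qed
    show ?thesis
    proof (cases "prob (B x) > e")
      case True
      have "(\<integral>\<^sup>+ y. indicator ?E (merge K J (x, y)) \<partial>Pi\<^sub>M J (\<lambda>_. M))
          = (\<integral>\<^sup>+ y. indicator (Pi\<^sub>E J (\<lambda>_. space M - B x)) y \<partial>Pi\<^sub>M J (\<lambda>_. M))"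
        using True mE by (intro nn_integral_cong) (auto simp: indicator_def)
      also have "\<dots> = emeasure (Pi\<^sub>M J (\<lambda>_. M)) (Pi\<^sub>E J (\<lambda>_. space M - B x))"
        using B[OF x] \<open>finite J\<close> by (intro nn_integral_indicator sets_PiM_I_finite) auto
      also have "\<dots> = (\<Prod>i\<in>J. emeasure M (space M - B x))"
        using B[OF x] \<open>finite J\<close> by (intro emeasure_PiM) auto
      also have "\<dots> = ennreal ((1 - prob (B x)) ^ card J)"
        using prob_compl[OF B[OF x]] by (simp add: emeasure_eq_measure ennreal_power)
      also have "\<dots> \<le> ennreal ((1 - e) ^ card J)"
        using True by (intro ennreal_leI power_mono) auto
      finally show ?thesis .
    next
      case False
      then have "(\<integral>\<^sup>+ y. indicator ?E (merge K J (x, y)) \<partial>Pi\<^sub>M J (\<lambda>_. M)) = (\<integral>\<^sup>+ y. 0 \<partial>Pi\<^sub>M J (\<lambda>_. M))"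
        using mE by (intro nn_integral_cong) (auto simp: indicator_def)
      then show ?thesis by simp
    qed
  qed
  have "emeasure (Pi\<^sub>M (K \<union> J) (\<lambda>_. M)) ?E = (\<integral>\<^sup>+ xs. indicator ?E xs \<partial>Pi\<^sub>M (K \<union> J) (\<lambda>_. M))"
    using E by simp
  also have "\<dots> = (\<integral>\<^sup>+ x. (\<integral>\<^sup>+ y. indicator ?E (merge K J (x, y)) \<partial>Pi\<^sub>M J (\<lambda>_. M)) \<partial>Pi\<^sub>M K (\<lambda>_. M))"
    using assms(1-3) E by (intro product_nn_integral_fold) auto
  also have "\<dots> \<le> (\<integral>\<^sup>+ x. ennreal ((1 - e) ^ card J) \<partial>Pi\<^sub>M K (\<lambda>_. M))"
    by (intro nn_integral_mono inner)
  also have "\<dots> = ennreal ((1 - e) ^ card J)"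
    by (simp add: PK.emeasure_space_1)
  finally show ?thesis .
qed

text \<open>Each residue class modulo \<open>n\<close> meets each of the \<open>m div n\<close> full
  blocks of length \<open>n\<close> once; quotient and remainder recover the pair
  \<open>(j, k)\<close>.\<close>

lemma card_residue_classes_ge:
  fixes m n :: nat
  assumes "J \<subseteq> {..<n}"
  shows "card {i\<in>{..<m}. i mod n \<in> J} \<ge> card J * (m div n)"
proof -
  have "card (J \<times> {..<m div n}) \<le> card {i\<in>{..<m}. i mod n \<in> J}"
  proof (rule card_inj_on_le[of "\<lambda>(j, k). k * n + j"])
    show "inj_on (\<lambda>(j, k). k * n + j) (J \<times> {..<m div n})"
    proof (rule inj_onI, clarify)
      fix j k j' k' assume jk: "j \<in> J" "j' \<in> J" "k * n + j = k' * n + j'"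
      with assms have "j < n" "j' < n" by auto
      then show "j = j' \<and> k = k'"
        using arg_cong[OF jk(3), of "\<lambda>x. x mod n"] arg_cong[OF jk(3), of "\<lambda>x. x div n"] by simp
    qed
    show "(\<lambda>(j, k). k * n + j) ` (J \<times> {..<m div n}) \<subseteq> {i\<in>{..<m}. i mod n \<in> J}"
    proof clarify
      fix j k assume "j \<in> J" "k < m div n"
      then have "j < n" "Suc k \<le> m div n" using assms by auto
      then have "Suc k * n \<le> m div n * n" by (intro mult_right_mono) auto
      also have "\<dots> \<le> m" by simp
      finally have "k * n + j < m" using \<open>j < n\<close> by simp
      then show "k * n + j \<in> {..<m} \<and> (k * n + j) mod n \<in> J"
        using \<open>j < n\<close> \<open>j \<in> J\<close> by simp
    qed
  qed auto
  then show ?thesis by (simp add: card_cartesian_product)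
qed

text \<open>Both factors are compared with exponentials: \<open>2 ^ (4 * d)\<close> with
  \<open>exp (4 * d)\<close> and \<open>(1 - \<epsilon>) ^ c\<close> with
  \<open>exp (- \<epsilon> * c)\<close>.\<close>

lemma residue_tail_le:
  fixes \<epsilon> \<delta> :: real
  assumes "0 < \<epsilon>" "\<epsilon> < 1/2" "0 < \<delta>" "\<delta> < 1"
    and m: "real m \<ge> 10 / \<epsilon> * (real d + ln (1 / \<delta>))" and "d \<ge> 1"
    and c: "2 * d * (m div (4 * d)) \<le> c"
  shows "2 ^ (4 * d) * (1 - \<epsilon>) ^ c \<le> \<delta>"
proof -
  \<comment> \<open>Rounding \<open>m\<close> down to a multiple of \<open>4 * d\<close> loses less
    than \<open>4 * d\<close> points, half of which would have counted towards
    \<open>c\<close>.\<close>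
  have "m < 4 * d + m div (4 * d) * (4 * d)"
    using \<open>d \<ge> 1\<close> by (intro dividend_less_div_times) simp
  also have "\<dots> \<le> 4 * d + 2 * c" using c by (simp add: mult_ac)
  finally have c': "real m / 2 - 2 * real d \<le> real c" by linarith
  have "2 \<le> exp (1::real)" using exp_ge_add_one_self[of 1] by simp
  then have two: "(2::real) ^ (4 * d) \<le> exp 1 ^ (4 * d)" by (intro power_mono) auto
  have L: "0 \<le> ln (1 / \<delta>)" using assms by simp
  \<comment> \<open>The constant 10 enters here: with \<open>L = ln (1 / \<delta>)\<close>,
    \<open>\<epsilon> * c\<close> is at least \<open>5 * (d + L) - d\<close>, which pays for the
    exponent \<open>4 * d\<close> and leaves at least \<open>L\<close>.\<close>
  have "\<epsilon> * real m \<ge> 10 * (real d + ln (1 / \<delta>))"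
    using m \<open>0 < \<epsilon>\<close> by (simp add: field_simps)
  moreover have "\<epsilon> * real d \<le> 1/2 * real d" using assms by (intro mult_right_mono) auto
  moreover have "\<epsilon> * (real m / 2 - 2 * real d) \<le> \<epsilon> * real c" using c' assms by (intro mult_left_mono) auto
  ultimately have key: "real (4 * d) - \<epsilon> * real c \<le> - ln (1 / \<delta>)"
    using L by (simp add: algebra_simps)
  have "(1 - \<epsilon>) ^ c \<le> exp (- \<epsilon>) ^ c"
    using exp_ge_add_one_self[of "- \<epsilon>"] assms by (intro power_mono) auto
  then have "2 ^ (4 * d) * (1 - \<epsilon>) ^ c \<le> exp 1 ^ (4 * d) * exp (- \<epsilon>) ^ c"
    using two assms by (intro mult_mono) auto
  also have "\<dots> = exp (real (4 * d) - \<epsilon> * real c)"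
    by (simp add: exp_of_nat_mult[symmetric] exp_add[symmetric] algebra_simps)
  also have "\<dots> \<le> exp (- ln (1 / \<delta>))" using key by simp
  also have "\<dots> = \<delta>" using assms by (simp add: ln_div)
  finally show ?thesis .
qed

section \<open>The part of the target missed by the box: measurability and tail bound\<close>

text \<open>The index set is a parameter so that boxes of subsamples can be formed.\<close>

definition positives :: "'a set \<Rightarrow> (nat \<Rightarrow> 'a) \<Rightarrow> nat set \<Rightarrow> 'a set" where
  "positives f xs I = xs ` {i\<in>I. xs i \<in> f}"

lemma space_cube_borel: "space (cube_borel d) = cube d"
  by (simp add: cube_borel_def cube_def space_PiM space_restrict_space)

lemma measurable_coordinate_cube_borel [measurable]:
  assumes "j < d"
  shows "(\<lambda>x. x j) \<in> borel_measurable (cube_borel d)"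
proof -
  have "(\<lambda>x. x j) \<in> cube_borel d \<rightarrow>\<^sub>M restrict_space borel {0..1}"
    using assms unfolding cube_borel_def by (intro measurable_component_singleton) auto
  then show ?thesis
    by (rule measurable_compose) (simp add: measurable_restrict_space1)
qed

lemma rect_in_sets: "rect d a b \<in> sets (cube_borel d)"
proof -
  have "{x \<in> space (cube_borel d). \<forall>i\<in>{..<d}. a i \<le> x i \<and> x i \<le> b i} \<in> sets (cube_borel d)"
    by measurable
  moreover have "rect d a b = {x \<in> space (cube_borel d). \<forall>i\<in>{..<d}. a i \<le> x i \<and> x i \<le> b i}"
    by (auto simp: rect_def space_cube_borel)
  ultimately show ?thesis by simp
qed

locale cube_prob_space = prob_space D for D :: "point measure" +
  fixes d :: nat and f :: "point set"
  assumes sets_D: "sets D = sets (cube_borel d)" and f [measurable]: "f \<in> sets D"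
begin

lemma space_D: "space D = cube d"
  using sets_eq_imp_space_eq[OF sets_D] by (simp add: space_cube_borel)

lemma measurable_coordinate [measurable]: "j < d \<Longrightarrow> (\<lambda>x. x j) \<in> borel_measurable D"
  using measurable_coordinate_cube_borel measurable_cong_sets[OF sets_D refl] by blast

text \<open>Two radii matter: \<open>t = 0\<close> gives the part of the target outside the box, and
  \<open>t = r\<close> the part from which the box is out of reach.\<close>

definition missed :: "real \<Rightarrow> (nat \<Rightarrow> point) \<Rightarrow> nat set \<Rightarrow> point set" where
  "missed t xs I = f - box_nbhd d t (positives f xs I)"

text \<open>Joint measurability in sample and point yields both the measurability of the missed mass
  and that of the event that a sample point is itself missed.\<close>

lemma missed_joint_measurable:
  assumes "finite I" "I \<subseteq> K"
  shows "{p \<in> space (Pi\<^sub>M K (\<lambda>_. D) \<Otimes>\<^sub>M D). snd p \<in> missed t (fst p) I}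
           \<in> sets (Pi\<^sub>M K (\<lambda>_. D) \<Otimes>\<^sub>M D)"
proof -
  let ?N = "Pi\<^sub>M K (\<lambda>_. D) \<Otimes>\<^sub>M D"
  have xi [measurable]: "(\<lambda>p. fst p i) \<in> ?N \<rightarrow>\<^sub>M D" if "i \<in> I" for i
    using assms that by (intro measurable_compose[OF measurable_fst] measurable_component_singleton) auto
  have xij [measurable]: "(\<lambda>p. fst p i j) \<in> borel_measurable ?N" if "i \<in> I" "j < d" for i j
    using measurable_compose[OF xi measurable_coordinate] that by blast
  have xj [measurable]: "(\<lambda>p. snd p j) \<in> borel_measurable ?N" if "j < d" for j
    using measurable_compose[OF measurable_snd measurable_coordinate] that by blast
  have "Measurable.pred ?N (\<lambda>p. snd p \<in> f \<and> \<not> (\<forall>j\<in>{..<d}.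
          (\<exists>i\<in>I. fst p i \<in> f \<and> fst p i j - t \<le> snd p j) \<and>
          (\<exists>i\<in>I. fst p i \<in> f \<and> snd p j \<le> fst p i j + t)))"
    using \<open>finite I\<close> by measurable
  moreover have "{p \<in> space ?N. snd p \<in> missed t (fst p) I} =
     {p \<in> space ?N. snd p \<in> f \<and> \<not> (\<forall>j\<in>{..<d}.
          (\<exists>i\<in>I. fst p i \<in> f \<and> fst p i j - t \<le> snd p j) \<and>
          (\<exists>i\<in>I. fst p i \<in> f \<and> snd p j \<le> fst p i j + t))}"
    by (auto simp: missed_def box_nbhd_def positives_def space_pair_measure space_D)
  ultimately show ?thesis unfolding pred_def by simp
qed

lemma missed_subset: "missed t xs I \<subseteq> space D"
  using sets.sets_into_space[OF f] by (auto simp: missed_def)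

lemma missed_measurable:
  assumes "finite I" "I \<subseteq> K" "xs \<in> space (Pi\<^sub>M K (\<lambda>_. D))"
  shows "missed t xs I \<in> sets D"
proof -
  have "Pair xs -` {p \<in> space (Pi\<^sub>M K (\<lambda>_. D) \<Otimes>\<^sub>M D). snd p \<in> missed t (fst p) I} = missed t xs I"
    using assms(3) missed_subset by (auto simp: space_pair_measure)
  with sets_Pair1[OF missed_joint_measurable[OF assms(1,2), of t], of xs] show ?thesis by (simp only:)
qed

lemma measurable_prob_missed:
  assumes "finite I" "I \<subseteq> K"
  shows "(\<lambda>xs. prob (missed t xs I)) \<in> borel_measurable (Pi\<^sub>M K (\<lambda>_. D))"
  by (intro measurable_measure missed_subset missed_joint_measurable assms)

lemma measurable_sample_missed:
  assumes "finite I" "I \<subseteq> K" "i \<in> K"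
  shows "Measurable.pred (Pi\<^sub>M K (\<lambda>_. D)) (\<lambda>xs. xs i \<in> missed t xs I)"
proof -
  \<comment> \<open>The event is the preimage of the joint set under this map.\<close>
  have "(\<lambda>xs. (xs, xs i)) \<in> Pi\<^sub>M K (\<lambda>_. D) \<rightarrow>\<^sub>M Pi\<^sub>M K (\<lambda>_. D) \<Otimes>\<^sub>M D"
    using assms(3) by (intro measurable_Pair measurable_component_singleton) simp_all
  from measurable_sets[OF this missed_joint_measurable[OF assms(1,2)]]
  show ?thesis
    using measurable_space[OF \<open>(\<lambda>xs. (xs, xs i)) \<in> _\<close>]
    by (auto simp: pred_def vimage_def Int_def conj_commute cong: rev_conj_cong)
qed

text \<open>
  The closure is a stable compression scheme: at most \<open>2 * d\<close> sample points attain the extreme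
  coordinates, so at most half of the \<open>4 * d\<close> residue classes already determine it.
\<close>

lemma missed_eq_missed_residues:
  assumes "d \<ge> 1" "xs \<in> space (Pi\<^sub>M {..<m} (\<lambda>_. D))"
  obtains I where "I \<subseteq> {..<4 * d}" "card I \<le> 2 * d"
    "missed t xs {i\<in>{..<m}. i mod (4 * d) \<in> I} = missed t xs {..<m}"
proof (cases "positives f xs {..<m} = {}")
  case True
  have "positives f xs {i\<in>{..<m}. i mod (4 * d) \<in> {}} = {}"
    by (simp add: positives_def)
  with True have "missed t xs {i\<in>{..<m}. i mod (4 * d) \<in> {}} = missed t xs {..<m}"
    by (simp only: missed_def)
  then show ?thesis using that[of "{}"] by simp
next
  case False
  let ?A = "positives f xs {..<m}"
  have "finite ?A" by (simp add: positives_def)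
  then obtain l h where lh: "\<And>j. l j \<in> ?A" "\<And>j. h j \<in> ?A"
      "\<And>j y. y \<in> ?A \<Longrightarrow> l j j \<le> y j \<and> y j \<le> h j j"
    using coordinate_extremes[OF _ False] by metis
  have "\<forall>j. \<exists>i. i < m \<and> xs i \<in> f \<and> l j = xs i" "\<forall>j. \<exists>i. i < m \<and> xs i \<in> f \<and> h j = xs i"
    using lh(1,2) by (auto simp: positives_def)
  then obtain p q where p: "\<And>j. p j < m \<and> xs (p j) \<in> f \<and> l j = xs (p j)"
      and q: "\<And>j. q j < m \<and> xs (q j) \<in> f \<and> h j = xs (q j)"
    by metis
  \<comment> \<open>Recording residues of the extreme indices instead of the indices themselves
    keeps the number of possible collections independent of \<open>m\<close>.\<close>
  define I where "I = (\<lambda>j. p j mod (4 * d)) ` {..<d} \<union> (\<lambda>j. q j mod (4 * d)) ` {..<d}"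
  let ?A' = "positives f xs {i\<in>{..<m}. i mod (4 * d) \<in> I}"
  have "card I \<le> card {..<d} + card {..<d}"
    unfolding I_def by (intro order_trans[OF card_Un_le] add_mono card_image_le) auto
  moreover have "I \<subseteq> {..<4 * d}" using \<open>d \<ge> 1\<close> by (auto simp: I_def)
  \<comment> \<open>The extreme points survive the restriction and still bound all remaining
    points.\<close>
  moreover have "box_nbhd d t ?A' = {x \<in> cube d. \<forall>j<d. l j j - t \<le> x j \<and> x j \<le> h j j + t}"
  proof (rule box_nbhd_eq[of d l _ h])
    fix j assume "j < d"
    then show "l j \<in> ?A'" "h j \<in> ?A'"
      using p[of j] q[of j] by (auto simp: positives_def I_def)
    fix y assume "y \<in> ?A'"
    then have "y \<in> ?A" by (auto simp: positives_def)
    then show "l j j \<le> y j \<and> y j \<le> h j j" by (rule lh(3))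
  qed
  moreover have "box_nbhd d t ?A = {x \<in> cube d. \<forall>j<d. l j j - t \<le> x j \<and> x j \<le> h j j + t}"
    using lh by (intro box_nbhd_eq[of d l _ h]) auto
  ultimately show ?thesis using that[of I] by (simp add: missed_def)
qed

text \<open>Union bound over the collections \<open>I\<close>: \<open>K I\<close> holds the indices
  that determine the box, \<open>J I\<close> the remaining ones, whose points must avoid the region
  that the box misses.\<close>

lemma emeasure_missed_gt_le:
  assumes "d \<ge> 1" "0 < e" "e \<le> 1"
  shows "emeasure (Pi\<^sub>M {..<m} (\<lambda>_. D)) {xs \<in> space (Pi\<^sub>M {..<m} (\<lambda>_. D)). prob (missed 0 xs {..<m}) > e}
          \<le> ennreal (2 ^ (4 * d) * (1 - e) ^ (2 * d * (m div (4 * d))))"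
proof -
  let ?P = "Pi\<^sub>M {..<m} (\<lambda>_. D)" and ?c = "2 * d * (m div (4 * d))"
  define K where "K I = {i\<in>{..<m}. i mod (4 * d) \<in> I}" for I
  define J where "J I = {i\<in>{..<m}. i mod (4 * d) \<in> {..<4 * d} - I}" for I
  define E where "E I = {xs \<in> space ?P. prob (missed 0 xs (K I)) > e \<and> (\<forall>i\<in>J I. xs i \<notin> missed 0 xs (K I))}" for I
  let ?I = "{I \<in> Pow {..<4 * d}. card I \<le> 2 * d}"
  have KJ: "K I \<inter> J I = {}" "K I \<union> J I = {..<m}" "finite (K I)" "finite (J I)" "K I \<subseteq> {..<m}" "J I \<subseteq> {..<m}" for I
    using \<open>d \<ge> 1\<close> by (auto simp: K_def J_def)
  have E: "E I \<in> sets ?P" for I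
  proof -
    have [measurable]: "(\<lambda>xs. prob (missed 0 xs (K I))) \<in> borel_measurable ?P"
      using KJ by (intro measurable_prob_missed)
    have [measurable]: "Measurable.pred ?P (\<lambda>xs. xs i \<in> missed 0 xs (K I))" if "i \<in> J I" for i
      using KJ(3,5)[of I] subsetD[OF KJ(6) that] by (intro measurable_sample_missed)
    show ?thesis unfolding E_def using KJ(4) by measurable
  qed
  have E_le: "emeasure ?P (E I) \<le> ennreal ((1 - e) ^ ?c)" if I: "I \<in> ?I" for I
  proof -
    have "emeasure ?P (E I) \<le> ennreal ((1 - e) ^ card (J I))"
      unfolding E_def KJ(2)[of I, symmetric]
    proof (rule emeasure_PiM_avoid_le)
      show "missed 0 xs (K I) = missed 0 ys (K I)" if "\<And>i. i \<in> K I \<Longrightarrow> xs i = ys i" for xs ys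
      proof -
        have "positives f xs (K I) = positives f ys (K I)"
          unfolding positives_def using that by (intro image_cong) auto
        then show ?thesis by (simp only: missed_def)
      qed
      show "missed 0 xs (K I) \<in> sets D" if "xs \<in> space (Pi\<^sub>M (K I) (\<lambda>_. D))" for xs
        using missed_measurable[OF KJ(3) order_refl that] .
      show "{xs \<in> space (Pi\<^sub>M (K I \<union> J I) (\<lambda>_. D)). prob (missed 0 xs (K I)) > e \<and>
          (\<forall>i\<in>J I. xs i \<notin> missed 0 xs (K I))} \<in> sets (Pi\<^sub>M (K I \<union> J I) (\<lambda>_. D))"
        using E[of I] unfolding E_def KJ(2) .
    qed (fact KJ assms)+
    also have "\<dots> \<le> ennreal ((1 - e) ^ ?c)"
    proof -
      \<comment> \<open>At least half of the \<open>4 * d\<close> classes stay outside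
        \<open>I\<close>, each with at least \<open>m div (4 * d)\<close> indices.\<close>
      have "2 * d \<le> card ({..<4 * d} - I)"
        using I by (subst card_Diff_subset) (auto intro: finite_subset)
      then have "?c \<le> card ({..<4 * d} - I) * (m div (4 * d))" by (rule mult_right_mono) simp
      also have "\<dots> \<le> card (J I)" unfolding J_def by (rule card_residue_classes_ge) auto
      finally show ?thesis using assms by (intro ennreal_leI power_decreasing) auto
    qed
    finally show ?thesis .
  qed
  have "{xs \<in> space ?P. prob (missed 0 xs {..<m}) > e} \<subseteq> (\<Union>I\<in>?I. E I)"
  proof
    fix xs assume "xs \<in> {xs \<in> space ?P. prob (missed 0 xs {..<m}) > e}"
    then have xs: "xs \<in> space ?P" "prob (missed 0 xs {..<m}) > e" by auto
    obtain I where I: "I \<subseteq> {..<4 * d}" "card I \<le> 2 * d" "missed 0 xs (K I) = missed 0 xs {..<m}"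
      unfolding K_def by (rule missed_eq_missed_residues[OF assms(1) xs(1), of 0])
    \<comment> \<open>No sample point is missed by the full box: positive points lie in it, and
      negative ones lie outside \<open>f\<close>.\<close>
    have "xs i \<notin> missed 0 xs {..<m}" if "i < m" for i
    proof -
      have "xs i \<in> cube d" using xs(1) that by (auto simp: space_PiM space_D)
      then show ?thesis using that by (auto simp: missed_def box_nbhd_def positives_def)
    qed
    then have "xs \<in> E I" using xs I(3) by (auto simp: E_def J_def)
    then show "xs \<in> (\<Union>I\<in>?I. E I)" using I(1,2) by blast
  qed
  then have "emeasure ?P {xs \<in> space ?P. prob (missed 0 xs {..<m}) > e} \<le> emeasure ?P (\<Union>I\<in>?I. E I)"
    using E by (intro emeasure_mono sets.finite_UN) auto
  also have "\<dots> \<le> (\<Sum>I\<in>?I. emeasure ?P (E I))"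
    using E by (intro emeasure_subadditive_finite) auto
  also have "\<dots> \<le> (\<Sum>I\<in>?I. ennreal ((1 - e) ^ ?c))"
    by (intro sum_mono E_le)
  also have "\<dots> = ennreal (real (card ?I) * (1 - e) ^ ?c)"
    using assms by (simp add: ennreal_mult ennreal_of_nat_eq_real_of_nat)
  also have "\<dots> \<le> ennreal (2 ^ (4 * d) * (1 - e) ^ ?c)"
  proof -
    have "card ?I \<le> card (Pow {..<4 * d})" by (intro card_mono) auto
    then have "card ?I \<le> 2 ^ (4 * d)" by (simp add: card_Pow)
    from of_nat_mono[OF this, where 'a = real] have "real (card ?I) \<le> 2 ^ (4 * d)" by simp
    then show ?thesis using assms by (intro ennreal_leI mult_right_mono) auto
  qed
  finally show ?thesis .
qed

end

section \<open>Loss and improvement region of the closure algorithm\<close>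

lemma closure_alg_eq_box_nbhd:
  assumes "d \<ge> 1" "\<And>i. i < m \<Longrightarrow> xs i \<in> cube d"
  shows "closure_alg d m (labeled f xs) = box_nbhd d 0 (positives f xs {..<m})"
proof -
  have "{fst (labeled f xs i) | i. i < m \<and> snd (labeled f xs i)} = positives f xs {..<m}"
    by (auto simp: labeled_def positives_def)
  moreover have "CLOS (cube d) (H_rec d) (positives f xs {..<m}) = box_nbhd d 0 (positives f xs {..<m})"
    using assms by (intro CLOS_rec_eq) (auto simp: positives_def)
  ultimately show ?thesis by (simp only: closure_alg_def)
qed

text \<open>The target is one of the rectangles that are intersected.\<close>

lemma closure_alg_subset:
  assumes "f \<in> H_rec d"
  shows "closure_alg d m (labeled f xs) \<subseteq> f"
  using assms unfolding closure_alg_def CLOS_def labeled_def by auto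

lemma box_nbhd_mono:
  assumes "s \<le> t"
  shows "box_nbhd d s A \<subseteq> box_nbhd d t A"
proof -
  have "u - t \<le> v" if "u - s \<le> v" for u v using assms that by linarith
  moreover have "v \<le> u + t" if "v \<le> u + s" for u v using assms that by linarith
  ultimately show ?thesis unfolding box_nbhd_def by blast
qed

text \<open>The box lies inside the target, so reaching a point of both is the same as reaching the
  box.\<close>

lemma IR_closure_alg_eq:
  assumes "d \<ge> 1" "r > 0" "f \<in> H_rec d" "\<And>i. i < m \<Longrightarrow> xs i \<in> cube d"
  shows "IR (cube d) (linf_ball d r) (closure_alg d m (labeled f xs)) f
    = box_nbhd d r (positives f xs {..<m}) - box_nbhd d 0 (positives f xs {..<m})"
proof -
  let ?A = "positives f xs {..<m}"
  have R: "closure_alg d m (labeled f xs) = box_nbhd d 0 ?A"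
    using assms by (intro closure_alg_eq_box_nbhd)
  have "box_nbhd d 0 ?A \<subseteq> f"
    using closure_alg_subset[OF assms(3), of m xs] R by simp
  moreover have "?A \<subseteq> cube d" using assms(4) by (auto simp: positives_def)
  then have "\<And>x. x \<in> cube d \<Longrightarrow> (\<exists>x'\<in>linf_ball d r x. x' \<in> box_nbhd d 0 ?A) \<longleftrightarrow> x \<in> box_nbhd d r ?A"
    using assms(1,2) by (intro reach_box_nbhd) auto
  moreover have "box_nbhd d r ?A \<subseteq> cube d" by (auto simp: box_nbhd_def)
  ultimately show ?thesis
    unfolding IR_def R by blast
qed

lemma (in cube_prob_space) pop_loss_closure_alg:
  assumes "d \<ge> 1" "r > 0" "f \<in> H_rec d" "\<And>i. i < m \<Longrightarrow> xs i \<in> cube d"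
  shows "pop_loss D (linf_ball d r) (closure_alg d m (labeled f xs)) f = prob (missed r xs {..<m})"
proof -
  let ?R = "closure_alg d m (labeled f xs)" and ?A = "positives f xs {..<m}"
  have "?A \<subseteq> cube d" using assms(4) by (auto simp: positives_def)
  then have reach: "\<And>x. x \<in> cube d \<Longrightarrow> (\<exists>x'\<in>linf_ball d r x. x' \<in> box_nbhd d 0 ?A) \<longleftrightarrow> x \<in> box_nbhd d r ?A"
    using assms(1,2) by (intro reach_box_nbhd) auto
  have "f \<subseteq> cube d" using assms(3) by (auto simp: H_rec_def rect_def)
  have R: "?R = box_nbhd d 0 ?A"
    using assms by (intro closure_alg_eq_box_nbhd)
  have "loss (linf_ball d r) ?R f x = 1 \<longleftrightarrow>
      x \<in> f \<and> x \<notin> box_nbhd d 0 ?A \<and> \<not> (\<exists>x'\<in>linf_ball d r x. x' \<in> box_nbhd d 0 ?A)" for x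
    using loss_eq_1_iff[OF closure_alg_subset[OF assms(3), of m xs]] unfolding R .
  moreover have "box_nbhd d 0 ?A \<subseteq> box_nbhd d r ?A" using \<open>r > 0\<close> by (intro box_nbhd_mono) simp
  ultimately have "x \<in> cube d \<and> loss (linf_ball d r) ?R f x = 1 \<longleftrightarrow> x \<in> missed r xs {..<m}" for x
    using reach[of x] \<open>f \<subseteq> cube d\<close> unfolding missed_def by blast
  then have "{x \<in> space D. loss (linf_ball d r) ?R f x = 1} = missed r xs {..<m}"
    unfolding space_D by blast
  then show ?thesis by (simp add: pop_loss_def)
qed

text \<open>The missed mass \<open>p 0 xs\<close> splits into the loss \<open>p r xs\<close> and the
  mass of the improvement region inside the target, so the claim reduces to the tail bound for
  \<open>p 0 xs\<close>.\<close>

lemma (in cube_prob_space) closure_alg_guarantee: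
  assumes "d \<ge> 1" "r > 0" "f \<in> H_rec d" "0 < \<epsilon>" "\<epsilon> < 1/2" "0 < \<delta>" "\<delta> < 1"
    and m: "real m \<ge> 10 / \<epsilon> * (real d + ln (1 / \<delta>))"
  shows "\<P>(xs in Pi\<^sub>M {..<m} (\<lambda>_. D).
           let Rc = closure_alg d m (labeled f xs) in
             pop_loss D (linf_ball d r) Rc f
               \<le> max 0 (\<epsilon> - \<P>(x in D. x \<in> IR (cube d) (linf_ball d r) Rc f \<inter> f)))
          \<ge> 1 - \<delta>"
proof -
  let ?P = "Pi\<^sub>M {..<m} (\<lambda>_. D)"
  interpret P: prob_space ?P by (intro prob_space_PiM prob_space_axioms)
  define p where "p t xs = prob (missed t xs {..<m})" for t xs
  have [measurable]: "p t \<in> borel_measurable ?P" for t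
    unfolding p_def by (intro measurable_prob_missed) auto
  have IR_prob: "\<P>(x in D. x \<in> IR (cube d) (linf_ball d r) (closure_alg d m (labeled f xs)) f \<inter> f) = p 0 xs - p r xs"
    and loss: "pop_loss D (linf_ball d r) (closure_alg d m (labeled f xs)) f = p r xs"
    if xs: "xs \<in> space ?P" for xs
  proof -
    have c: "\<And>i. i < m \<Longrightarrow> xs i \<in> cube d" using xs by (auto simp: space_PiM space_D)
    show "pop_loss D (linf_ball d r) (closure_alg d m (labeled f xs)) f = p r xs"
      unfolding p_def using assms c by (intro pop_loss_closure_alg)
    have IR: "IR (cube d) (linf_ball d r) (closure_alg d m (labeled f xs)) f
        = box_nbhd d r (positives f xs {..<m}) - box_nbhd d 0 (positives f xs {..<m})"
      using assms c by (intro IR_closure_alg_eq)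
    have "{x \<in> space D. x \<in> IR (cube d) (linf_ball d r) (closure_alg d m (labeled f xs)) f \<inter> f}
        = missed 0 xs {..<m} - missed r xs {..<m}"
      using missed_subset[of 0 xs "{..<m}"]
      unfolding IR missed_def by auto
    moreover have "missed r xs {..<m} \<subseteq> missed 0 xs {..<m}"
      unfolding missed_def using box_nbhd_mono[of 0 r] \<open>r > 0\<close> by (intro Diff_mono) auto
    ultimately show "\<P>(x in D. x \<in> IR (cube d) (linf_ball d r) (closure_alg d m (labeled f xs)) f \<inter> f) = p 0 xs - p r xs"
      unfolding p_def using missed_measurable[OF _ order_refl xs] by (simp add: finite_measure_Diff)
  qed
  let ?Bad = "{xs \<in> space ?P. p 0 xs > \<epsilon>}"
  have "emeasure ?P ?Bad \<le> ennreal (2 ^ (4 * d) * (1 - \<epsilon>) ^ (2 * d * (m div (4 * d))))"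
    unfolding p_def using assms by (intro emeasure_missed_gt_le) auto
  also have "\<dots> \<le> ennreal \<delta>"
    using assms by (intro ennreal_leI residue_tail_le) auto
  finally have bad: "P.prob ?Bad \<le> \<delta>"
    using \<open>0 < \<delta>\<close> by (simp add: P.emeasure_eq_measure)
  have "1 - \<delta> \<le> P.prob (space ?P - ?Bad)"
    using bad by (subst P.prob_compl) auto
  \<comment> \<open>If \<open>p 0 xs \<le> \<epsilon>\<close>, then
    \<open>p r xs = p 0 xs - (p 0 xs - p r xs)\<close> is at most
    \<open>\<epsilon> - (p 0 xs - p r xs)\<close>.\<close>
  also have "\<dots> \<le> P.prob {xs \<in> space ?P. p r xs \<le> max 0 (\<epsilon> - (p 0 xs - p r xs))}"
    by (intro P.finite_measure_mono) auto
  also have "{xs \<in> space ?P. p r xs \<le> max 0 (\<epsilon> - (p 0 xs - p r xs))} = {xs \<in> space ?P.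
      let Rc = closure_alg d m (labeled f xs) in
             pop_loss D (linf_ball d r) Rc f
               \<le> max 0 (\<epsilon> - \<P>(x in D. x \<in> IR (cube d) (linf_ball d r) Rc f \<inter> f))}"
    unfolding Let_def by (intro Collect_cong conj_cong refl) (simp only: IR_prob loss)
  finally show ?thesis .
qed

section \<open>Area of the improvement region in the unit square\<close>

lemma prob_space_uniform_unit: "prob_space (restrict_space lborel {0..1::real})"
  by (intro prob_spaceI) (simp add: space_restrict_space emeasure_restrict_space)

lemma space_uniform_cube: "space (uniform_cube d) = cube d"
  by (simp add: uniform_cube_def cube_def space_PiM space_restrict_space)

lemma prob_space_uniform_cube: "prob_space (uniform_cube d)"
  unfolding uniform_cube_def by (intro prob_space_PiM prob_space_uniform_unit)

text \<open>The bounds keep every edge inside the unit interval, so the volume is the full product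
  of the edge lengths.\<close>

lemma uniform_cube_box:
  assumes "\<And>i. i < d \<Longrightarrow> 0 \<le> u i \<and> u i \<le> v i \<and> v i \<le> 1"
  shows "{x \<in> cube d. \<forall>i<d. u i \<le> x i \<and> x i \<le> v i} \<in> sets (uniform_cube d)" (is "?B \<in> _")
    and "measure (uniform_cube d) {x \<in> cube d. \<forall>i<d. u i \<le> x i \<and> x i \<le> v i} = (\<Prod>i<d. v i - u i)"
proof -
  let ?M = "\<lambda>_::nat. restrict_space lborel {0..1::real}"
  interpret product_sigma_finite ?M
    by (simp add: product_sigma_finite_def prob_space_imp_sigma_finite prob_space_uniform_unit)
  have B: "?B = Pi\<^sub>E {..<d} (\<lambda>i. {u i..v i})"
  proof -
    have "0 \<le> x i \<and> x i \<le> 1" if "i < d" "u i \<le> x i" "x i \<le> v i" for x i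
      using assms[OF that(1)] that by linarith
    then show ?thesis by (auto simp: cube_def PiE_iff extensional_def)
  qed
  have s: "{u i..v i} \<in> sets (?M i)" if "i < d" for i
    using assms[OF that] by (auto simp: sets_restrict_space_iff)
  show "?B \<in> sets (uniform_cube d)"
    unfolding B uniform_cube_def using s by (intro sets_PiM_I_finite) auto
  have "emeasure (uniform_cube d) ?B = (\<Prod>i<d. emeasure (?M i) {u i..v i})"
    unfolding B uniform_cube_def using s by (intro emeasure_PiM) auto
  also have "\<dots> = (\<Prod>i<d. ennreal (v i - u i))"
    using assms by (intro prod.cong refl) (auto simp: emeasure_restrict_space)
  also have "\<dots> = ennreal (\<Prod>i<d. v i - u i)"
    using assms by (intro prod_ennreal) auto
  finally show "measure (uniform_cube d) ?B = (\<Prod>i<d. v i - u i)"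
    using assms by (intro measure_eq_emeasure_eq_ennreal prod_nonneg) auto
qed

text \<open>The region is a frame of width \<open>r\<close> around \<open>Rc\<close>, with area
  \<open>(l1 + 2 * r) * (l2 + 2 * r) - l1 * l2\<close> for side lengths \<open>l1\<close> and
  \<open>l2\<close>. The margin assumption keeps the frame from being cut off by the square.\<close>

lemma uniform_square_IR:
  assumes "r > 0" "f \<in> H_rec 2" and xs: "\<forall>i<m. xs i \<in> cube 2"
    and Rc: "Rc = closure_alg 2 m (labeled f xs)" "Rc \<noteq> {}"
    and margin: "\<forall>x\<in>Rc. \<forall>i<2. r \<le> x i \<and> x i + r \<le> 1"
  shows "\<P>(x in uniform_cube 2. x \<in> IR (cube 2) (linf_ball 2 r) Rc f)
           = 2 * r * (side_length 0 Rc + side_length 1 Rc) + 4 * r\<^sup>2"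
proof -
  interpret U: prob_space "uniform_cube 2" by (rule prob_space_uniform_cube)
  let ?A = "positives f xs {..<m}"
  have R: "Rc = box_nbhd 2 0 ?A"
    unfolding Rc(1) using xs by (intro closure_alg_eq_box_nbhd) auto
  \<comment> \<open>A nonempty box forces a positive example: already coordinate 0 needs a witness
    in \<open>?A\<close>.\<close>
  have "?A \<noteq> {}" using Rc(2) unfolding R box_nbhd_def by (auto dest!: spec[of _ "0::nat"])
  moreover have "finite ?A" by (simp add: positives_def)
  ultimately obtain l h where lh: "\<And>j. l j \<in> ?A" "\<And>j. h j \<in> ?A"
      "\<And>j y. y \<in> ?A \<Longrightarrow> l j j \<le> y j \<and> y j \<le> h j j"
    using coordinate_extremes by metis
  have box: "box_nbhd 2 t ?A = {x \<in> cube 2. \<forall>j<2. l j j - t \<le> x j \<and> x j \<le> h j j + t}" for t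
    using lh by (intro box_nbhd_eq[of 2 l _ h]) auto
  have "?A \<subseteq> cube 2" using xs by (auto simp: positives_def)
  then have "?A \<subseteq> Rc" unfolding R box using lh(3) by auto
  then have mem: "l j \<in> Rc" "h j \<in> Rc" for j using lh(1,2) by auto
  have bounds: "r \<le> l j j" "l j j \<le> h j j" "h j j + r \<le> 1" if "j < 2" for j
    using margin mem[of j] lh(3)[OF lh(1), of j j] that by auto
  have "side_length j Rc = h j j - l j j" if "j < 2" for j
  proof -
    \<comment> \<open>Supremum and infimum are attained at the extreme points, which belong to
      \<open>Rc\<close>.\<close>
    have "(SUP x\<in>Rc. x j) = h j j" "(INF x\<in>Rc. x j) = l j j"
      using mem[of j] that unfolding R box by (intro cSup_eq_maximum cInf_eq_minimum; auto)+
    then show ?thesis by (simp add: side_length_def)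
  qed
  then have side: "side_length 0 Rc = h 0 0 - l 0 0" "side_length 1 Rc = h 1 1 - l 1 1" by simp_all
  have m: "box_nbhd 2 t ?A \<in> U.events"
      "U.prob (box_nbhd 2 t ?A) = (h 0 0 - l 0 0 + 2 * t) * (h 1 1 - l 1 1 + 2 * t)"
    if t: "0 \<le> t" "t \<le> r" for t
  proof -
    have b: "0 \<le> l j j - t \<and> l j j - t \<le> h j j + t \<and> h j j + t \<le> 1" if "j < 2" for j
      using bounds[OF that] t by linarith
    show "box_nbhd 2 t ?A \<in> U.events"
      unfolding box by (rule uniform_cube_box(1)[OF b])
    have "U.prob (box_nbhd 2 t ?A) = (\<Prod>j<2. h j j + t - (l j j - t))"
      unfolding box by (rule uniform_cube_box(2)[OF b])
    also have "\<dots> = (h 0 0 - l 0 0 + 2 * t) * (h 1 1 - l 1 1 + 2 * t)"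
      by (simp add: numeral_2_eq_2 algebra_simps)
    finally show "U.prob (box_nbhd 2 t ?A) = (h 0 0 - l 0 0 + 2 * t) * (h 1 1 - l 1 1 + 2 * t)" .
  qed
  have "{x \<in> space (uniform_cube 2). x \<in> IR (cube 2) (linf_ball 2 r) Rc f} = box_nbhd 2 r ?A - box_nbhd 2 0 ?A"
    unfolding Rc(1) space_uniform_cube using assms(1,2) xs
    by (subst IR_closure_alg_eq) (auto simp: box_nbhd_def)
  then have diff: "\<P>(x in uniform_cube 2. x \<in> IR (cube 2) (linf_ball 2 r) Rc f)
      = U.prob (box_nbhd 2 r ?A) - U.prob (box_nbhd 2 0 ?A)"
    using m(1) \<open>r > 0\<close> box_nbhd_mono[of 0 r 2 ?A] by (simp add: U.finite_measure_Diff)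
  have "U.prob (box_nbhd 2 r ?A) = (h 0 0 - l 0 0 + 2 * r) * (h 1 1 - l 1 1 + 2 * r)"
      "U.prob (box_nbhd 2 0 ?A) = (h 0 0 - l 0 0) * (h 1 1 - l 1 1)"
    using m(2)[of r] m(2)[of 0] \<open>r > 0\<close> by simp_all
  then show ?thesis unfolding diff side by (simp add: algebra_simps power2_eq_square)
qed
theorem theorem4p6:
  shows "(\<exists>C::real. C > 0 \<and>
     (\<forall>(d::nat) (r::real) (D::point measure) (Rstar::point set) (\<epsilon>::real) (\<delta>::real) (m::nat).
        d \<ge> 1 \<longrightarrow> r > 0 \<longrightarrow>
        prob_space D \<longrightarrow> sets D = sets (cube_borel d) \<longrightarrow>
        Rstar \<in> H_rec d \<longrightarrow>
        0 < \<epsilon> \<longrightarrow> \<epsilon> < 1/2 \<longrightarrow> 0 < \<delta> \<longrightarrow> \<delta> < 1/2 \<longrightarrow>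
        real m \<ge> C / \<epsilon> * (real d + ln (1 / \<delta>)) \<longrightarrow>
        \<P>(xs in Pi\<^sub>M {..<m} (\<lambda>_. D).
           let Rc = closure_alg d m (labeled Rstar xs) in
             pop_loss D (linf_ball d r) Rc Rstar
               \<le> max 0 (\<epsilon> - \<P>(x in D. x \<in> IR (cube d) (linf_ball d r) Rc Rstar \<inter> Rstar)))
          \<ge> 1 - \<delta>))
   \<and> (\<forall>(r::real) (Rstar::point set) (m::nat) (xs::nat \<Rightarrow> point) (Rc::point set).
        r > 0 \<longrightarrow>
        Rstar \<in> H_rec 2 \<longrightarrow>
        (\<forall>i<m. xs i \<in> cube 2) \<longrightarrow>
        Rc = closure_alg 2 m (labeled Rstar xs) \<longrightarrow>
        Rc \<noteq> {} \<longrightarrow>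
        (\<forall>x\<in>Rc. \<forall>i<2. r \<le> x i \<and> x i + r \<le> 1) \<longrightarrow>
        \<P>(x in uniform_cube 2. x \<in> IR (cube 2) (linf_ball 2 r) Rc Rstar)
          = 2 * r * (side_length 0 Rc + side_length 1 Rc) + 4 * r\<^sup>2)"
\<comment> \<open>The witness 10 is the constant of \<open>residue_tail_le\<close>.\<close>
proof (intro conjI exI[of _ 10] allI impI)
  fix d :: nat and r :: real and D :: "point measure" and Rstar :: "point set" and \<epsilon> \<delta> :: real and m :: nat
  assume h: "d \<ge> 1" "r > 0" "prob_space D" "sets D = sets (cube_borel d)" "Rstar \<in> H_rec d"
    "0 < \<epsilon>" "\<epsilon> < 1/2" "0 < \<delta>" "\<delta> < 1/2" "real m \<ge> 10 / \<epsilon> * (real d + ln (1 / \<delta>))"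
  interpret prob_space D by fact
  interpret cube_prob_space D d Rstar
    using h(4,5) rect_in_sets by unfold_locales (auto simp: H_rec_def)
  show "\<P>(xs in Pi\<^sub>M {..<m} (\<lambda>_. D).
           let Rc = closure_alg d m (labeled Rstar xs) in
             pop_loss D (linf_ball d r) Rc Rstar
               \<le> max 0 (\<epsilon> - \<P>(x in D. x \<in> IR (cube d) (linf_ball d r) Rc Rstar \<inter> Rstar)))
          \<ge> 1 - \<delta>"
    using h by (intro closure_alg_guarantee) auto
qed (simp, rule uniform_square_IR)

end
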